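(* Let $G$ be a discrete group acting on itself by conjugation, and let $w\in Z^3(G,\mathbb T)$ be a normalized 3-cocycle. Define $$\alpha_w[g|h||x]=\frac{w[g|h|x]\;w[ghxh^{-1}g^{-1}|g|h]}{w[g|hxh^{-1}|h]},\qquad \beta_w[g||x|y]=\frac{w[g|x|y]\;w[gxg^{-1}|gyg^{-1}|g]}{w[gxg^{-1}|g|y]},\qquad \theta_w[x|y|z]=w[x|y|z].$$ Then the 3-cocycle $\alpha_w\oplus\beta_w\oplus\theta_w\in Z^3(\mathrm{Tot}^*(A^{*,*}(G\rtimes G,\mathbb T)))$ equals $\tau_1^\vee w$, the image of $w$ under the restricted shuffle homomorphism $\tau_1^\vee$.
   Context: $\mathbb T=S^1$, written multiplicatively. Let $G$ act on $K=G$ by conjugation, $g(k)=gkg^{-1}$. $C^{p,q}(G\rtimes G,\mathbb T)$ is the group of maps $F:G^p\times K^q\to\mathbb T$, values $F[g_1|\dots|g_p||k_1|\dots|k_q]$, equal to $1$ if some $g_i$ or $k_j$ is $1$. $A^{*,*}(G\rtimes G,\mathbb T)$ consists of those $C^{p,q}$ with $q>0$, with differentials $(\delta_GF)[g_1|\dots|g_{p+1}||k_1|\dots|k_q]=F[g_2|\dots|g_{p+1}||k_1|\dots|k_q]\prod_{i=1}^pF[\dots|g_ig_{i+1}|\dots||k_1|\dots|k_q]^{(-1)^i}F[g_1|\dots|g_p||g_{p+1}(k_1)|\dots|g_{p+1}(k_q)]^{(-1)^{p+1}}$ and $(\delta_KF)[g_1|\dots|g_p||k_1|\dots|k_{q+1}]=F[\dots||k_2|\dots|k_{q+1}]\prod_{j=1}^qF[\dots||\dots|k_jk_{j+1}|\dots]^{(-1)^j}F[\dots||k_1|\dots|k_q]^{(-1)^{q+1}}$;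 the total complex has differential $\delta_G\oplus\delta_K^{(-1)^p}$. A $(p,q)$-shuffle is $\lambda\in\mathfrak S_{p+q}$ with $\lambda(i)<\lambda(j)$ whenever $1\le i<j\le p$ or $p+1\le i<j\le p+q$. Set $\lambda[g_1|\dots|g_p|k_1|\dots|k_q]=[s_1|\dots|s_{p+q}]$ with $s_{\lambda(i)}=g_i$ for $i\le p$ and $s_{\lambda(i)}=u\,k_{i-p}\,u^{-1}$, $u=g_{p+\lambda(i)-i+1}\cdots g_{p-1}g_p$ (empty product $=1$), for $i>p$, and $\tau[g_1|\dots|g_p||k_1|\dots|k_q]=\sum_{\lambda}(-1)^{|\lambda|}\lambda[g_1|\dots|g_p|k_1|\dots|k_q]$, sum over all $(p,q)$-shuffles, $(-1)^{|\lambda|}$ the sign of $\lambda$. The restricted shuffle homomorphism is $$\tau_1^\vee:C^n(G,\mathbb T)\to\bigoplus_{p+q=n,\ q>0}A^{p,q}(G\rtimes G,\mathbb T),\qquad(\tau_1^\vee F)[s_1|\dots|s_n]=\bigoplus_{p+q=n,\ q>0}F(\tau[s_1|\dots|s_p||s_{p+1}|\dots|s_{p+q}]),$$ where $C^n(G,\mathbb T)$ denotes normalized bar cochains and $F$ is extended to formal integer combinations of symbols as a homomorphism to $\mathbb T$. *)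

theory Defs
  imports Complex_Main "HOL-Algebra.Coset" "HOL-Algebra.Product_Groups"
    "HOL-Library.Poly_Mapping" "HOL-Combinatorics.Permutations"
begin

definition circle_group :: "complex monoid" where
  "circle_group = \<lparr>carrier = {z. cmod z = 1}, monoid.mult = (*), one = 1\<rparr>"

definition conjugate :: "('a, 'm) monoid_scheme \<Rightarrow> 'a \<Rightarrow> 'a \<Rightarrow> 'a" where
  "conjugate G g k = g \<otimes>\<^bsub>G\<^esub> k \<otimes>\<^bsub>G\<^esub> inv\<^bsub>G\<^esub> g"

definition tuples :: "('a, 'm) monoid_scheme \<Rightarrow> nat \<Rightarrow> 'a list set" where
  "tuples G n = {xs \<in> lists (carrier G). length xs = n}"

text \<open>
  Cochains are extensional functions on tuples, with pointwise multiplication, so that equality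
  of cochains is equality on the tuples over the group. A bar symbol \<open>[g\<^sub>1|...|g\<^sub>n]\<close> is a list.
  A symbol \<open>[g\<^sub>1|...|g\<^sub>p||k\<^sub>1|...|k\<^sub>q]\<close> is a pair of lists.
\<close>

definition bar_cochains :: "('a, 'm) monoid_scheme \<Rightarrow> nat \<Rightarrow> ('a list \<Rightarrow> complex) monoid" where
  "bar_cochains G n =
     (product_group (tuples G n) (\<lambda>_. circle_group))
       \<lparr>carrier := {F \<in> tuples G n \<rightarrow>\<^sub>E carrier circle_group.
                      \<forall>gs \<in> tuples G n. \<one>\<^bsub>G\<^esub> \<in> set gs \<longrightarrow> F gs = 1}\<rparr>"

definition double_cochains ::
    "('a, 'm) monoid_scheme \<Rightarrow> nat \<Rightarrow> nat \<Rightarrow> ('a list \<times> 'a list \<Rightarrow> complex) monoid" where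
  "double_cochains G p q =
     (product_group (tuples G p \<times> tuples G q) (\<lambda>_. circle_group))
       \<lparr>carrier := {F \<in> tuples G p \<times> tuples G q \<rightarrow>\<^sub>E carrier circle_group.
                      \<forall>(gs, ks) \<in> tuples G p \<times> tuples G q.
                        \<one>\<^bsub>G\<^esub> \<in> set gs \<union> set ks \<longrightarrow> F (gs, ks) = 1}\<rparr>"

text \<open>
  The list \<open>[x\<^sub>1, ..., x\<^sub>ix\<^sub>i\<^sub>+\<^sub>1, ..., x\<^sub>n]\<close>, with positions counted from 1.
\<close>

definition merge_at :: "('a, 'm) monoid_scheme \<Rightarrow> nat \<Rightarrow> 'a list \<Rightarrow> 'a list" where
  "merge_at G i xs =
     take (i - 1) xs @ [xs ! (i - 1) \<otimes>\<^bsub>G\<^esub> xs ! i] @ drop (i + 1) xs"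

text \<open>
  In the differentials below, \<open>G\<close> acts trivially on the coefficient group, and the integer
  power \<open>powi\<close> of a complex number of modulus 1 is its power in the circle group.
\<close>

definition bar_diff ::
    "('a, 'm) monoid_scheme \<Rightarrow> nat \<Rightarrow> ('a list \<Rightarrow> complex) \<Rightarrow> 'a list \<Rightarrow> complex" where
  "bar_diff G n F = (\<lambda>gs \<in> tuples G (n + 1).
     F (tl gs)
     * (\<Prod>i = 1..n. F (merge_at G i gs) powi ((-1) ^ i))
     * F (take n gs) powi ((-1) ^ (n + 1)))"

definition delta_G ::
    "('a, 'm) monoid_scheme \<Rightarrow> nat \<Rightarrow> nat \<Rightarrow> ('a list \<times> 'a list \<Rightarrow> complex)
       \<Rightarrow> 'a list \<times> 'a list \<Rightarrow> complex" where
  "delta_G G p q F = (\<lambda>(gs, ks) \<in> tuples G (p + 1) \<times> tuples G q.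
     F (tl gs, ks)
     * (\<Prod>i = 1..p. F (merge_at G i gs, ks) powi ((-1) ^ i))
     * F (take p gs, map (conjugate G (gs ! p)) ks) powi ((-1) ^ (p + 1)))"

definition delta_K ::
    "('a, 'm) monoid_scheme \<Rightarrow> nat \<Rightarrow> nat \<Rightarrow> ('a list \<times> 'a list \<Rightarrow> complex)
       \<Rightarrow> 'a list \<times> 'a list \<Rightarrow> complex" where
  "delta_K G p q F = (\<lambda>(gs, ks) \<in> tuples G p \<times> tuples G (q + 1).
     F (gs, tl ks)
     * (\<Prod>j = 1..q. F (gs, merge_at G j ks) powi ((-1) ^ j))
     * F (gs, take q ks) powi ((-1) ^ (q + 1)))"

definition bar_cocycles :: "('a, 'm) monoid_scheme \<Rightarrow> nat \<Rightarrow> ('a list \<Rightarrow> complex) set" where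
  "bar_cocycles G n = kernel (bar_cochains G n) (bar_cochains G (n + 1)) (bar_diff G n)"

definition tot_index :: "nat \<Rightarrow> (nat \<times> nat) set" where
  "tot_index n = {(p, q). p + q = n \<and> q > 0}"

text \<open>
  The index set is finite, so the direct sum over it is the product group.
\<close>

definition tot_cochains ::
    "('a, 'm) monoid_scheme \<Rightarrow> nat \<Rightarrow> (nat \<times> nat \<Rightarrow> 'a list \<times> 'a list \<Rightarrow> complex) monoid" where
  "tot_cochains G n = product_group (tot_index n) (\<lambda>(p, q). double_cochains G p q)"

text \<open>
  The component of bidegree \<open>(p, q)\<close> receives \<open>\<delta>\<^sub>G\<close> from bidegree \<open>(p - 1, q)\<close> and
  \<open>\<delta>\<^sub>K\<close>, raised to the power \<open>(-1)\<^sup>p\<close>, from bidegree \<open>(p, q - 1)\<close>; the latter belongs to the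
  complex only if \<open>q - 1 > 0\<close>.
\<close>

definition tot_diff ::
    "('a, 'm) monoid_scheme \<Rightarrow> nat \<Rightarrow> (nat \<times> nat \<Rightarrow> 'a list \<times> 'a list \<Rightarrow> complex)
       \<Rightarrow> nat \<times> nat \<Rightarrow> 'a list \<times> 'a list \<Rightarrow> complex" where
  "tot_diff G n F = (\<lambda>(p, q) \<in> tot_index (n + 1). \<lambda>(gs, ks) \<in> tuples G p \<times> tuples G q.
     (if p > 0 then delta_G G (p - 1) q (F (p - 1, q)) (gs, ks) else 1)
     * (if q > 1 then delta_K G p (q - 1) (F (p, q - 1)) (gs, ks) powi ((-1) ^ p) else 1))"

definition tot_cocycles ::
    "('a, 'm) monoid_scheme \<Rightarrow> nat \<Rightarrow> (nat \<times> nat \<Rightarrow> 'a list \<times> 'a list \<Rightarrow> complex) set" where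
  "tot_cocycles G n = kernel (tot_cochains G n) (tot_cochains G (n + 1)) (tot_diff G n)"

definition shuffles_perm :: "nat \<Rightarrow> nat \<Rightarrow> (nat \<Rightarrow> nat) set" where
  "shuffles_perm p q = {l. l permutes {1..p + q}
     \<and> strict_mono_on {1..p} l \<and> strict_mono_on {p + 1..p + q} l}"

text \<open>
  The entry in position \<open>m\<close> is determined by the index \<open>i\<close> with \<open>l i = m\<close>. The dropped prefix has
  length \<open>p + l i - i\<close>, so that the remaining product is the element
  \<open>u\<close> starting at index \<open>p + l i - i + 1\<close>; for a shuffle \<open>l\<close> and \<open>i > p\<close> this
  natural-number subtraction is exact.
\<close>

definition shuffle_symbol ::
    "('a, 'm) monoid_scheme \<Rightarrow> nat \<Rightarrow> nat \<Rightarrow> (nat \<Rightarrow> nat) \<Rightarrow> 'a list \<times> 'a list \<Rightarrow> 'a list" where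
  "shuffle_symbol G p q l = (\<lambda>(gs, ks).
     map (\<lambda>m. let i = inv_into {1..p + q} l m in
            if i \<le> p then gs ! (i - 1)
            else conjugate G (foldr (\<otimes>\<^bsub>G\<^esub>) (drop (p + l i - i) gs) \<one>\<^bsub>G\<^esub>) (ks ! (i - p - 1)))
       [1..<p + q + 1])"

definition shuffle_sum ::
    "('a, 'm) monoid_scheme \<Rightarrow> nat \<Rightarrow> nat \<Rightarrow> 'a list \<times> 'a list \<Rightarrow> ('a list \<Rightarrow>\<^sub>0 int)" where
  "shuffle_sum G p q gk =
     (\<Sum>l \<in> shuffles_perm p q. frag_cmul (sign l) (frag_of (shuffle_symbol G p q l gk)))"

text \<open>
  The extension of \<open>F\<close> to formal integer combinations as a homomorphism to the circle group.
\<close>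

definition cochain_extend :: "('b \<Rightarrow> complex) \<Rightarrow> ('b \<Rightarrow>\<^sub>0 int) \<Rightarrow> complex" where
  "cochain_extend F c = (\<Prod>s \<in> Poly_Mapping.keys c. F s powi Poly_Mapping.lookup c s)"

definition restricted_shuffle_hom ::
    "('a, 'm) monoid_scheme \<Rightarrow> nat \<Rightarrow> ('a list \<Rightarrow> complex)
       \<Rightarrow> nat \<times> nat \<Rightarrow> 'a list \<times> 'a list \<Rightarrow> complex" where
  "restricted_shuffle_hom G n F = (\<lambda>(p, q) \<in> tot_index n. \<lambda>gk \<in> tuples G p \<times> tuples G q.
     cochain_extend F (shuffle_sum G p q gk))"

definition alpha_cochain ::
    "('a, 'm) monoid_scheme \<Rightarrow> ('a list \<Rightarrow> complex) \<Rightarrow> 'a list \<times> 'a list \<Rightarrow> complex" where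
  "alpha_cochain G w = (\<lambda>(gs, ks) \<in> tuples G 2 \<times> tuples G 1.
     let g = gs ! 0; h = gs ! 1; x = ks ! 0 in
       w [g, h, x]
       * w [g \<otimes>\<^bsub>G\<^esub> h \<otimes>\<^bsub>G\<^esub> x \<otimes>\<^bsub>G\<^esub> inv\<^bsub>G\<^esub> h \<otimes>\<^bsub>G\<^esub> inv\<^bsub>G\<^esub> g, g, h]
       / w [g, h \<otimes>\<^bsub>G\<^esub> x \<otimes>\<^bsub>G\<^esub> inv\<^bsub>G\<^esub> h, h])"

definition beta_cochain ::
    "('a, 'm) monoid_scheme \<Rightarrow> ('a list \<Rightarrow> complex) \<Rightarrow> 'a list \<times> 'a list \<Rightarrow> complex" where
  "beta_cochain G w = (\<lambda>(gs, ks) \<in> tuples G 1 \<times> tuples G 2.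
     let g = gs ! 0; x = ks ! 0; y = ks ! 1 in
       w [g, x, y]
       * w [g \<otimes>\<^bsub>G\<^esub> x \<otimes>\<^bsub>G\<^esub> inv\<^bsub>G\<^esub> g, g \<otimes>\<^bsub>G\<^esub> y \<otimes>\<^bsub>G\<^esub> inv\<^bsub>G\<^esub> g, g]
       / w [g \<otimes>\<^bsub>G\<^esub> x \<otimes>\<^bsub>G\<^esub> inv\<^bsub>G\<^esub> g, g, y])"

definition theta_cochain ::
    "('a, 'm) monoid_scheme \<Rightarrow> ('a list \<Rightarrow> complex) \<Rightarrow> 'a list \<times> 'a list \<Rightarrow> complex" where
  "theta_cochain G w = (\<lambda>(gs, ks) \<in> tuples G 0 \<times> tuples G 3.
     w [ks ! 0, ks ! 1, ks ! 2])"

text \<open>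
  The element \<open>a \<oplus> b \<oplus> c\<close> of the total complex in degree 3.
\<close>

definition oplus_tot3 :: "'b \<Rightarrow> 'b \<Rightarrow> 'b \<Rightarrow> nat \<times> nat \<Rightarrow> 'b" where
  "oplus_tot3 a b c = (\<lambda>pq \<in> tot_index 3.
     if pq = (2, 1) then a else if pq = (1, 2) then b else c)"

end

(*
  Over a (p,q)-symbol with p + q = 3 there are three shuffles when p and q are positive and one
  when p = 0, and evaluating w on their signed sum gives the formulas for alpha, beta and theta.
  In the total complex, each component of the differential of the result is the product of the
  values of the coboundary of w on the signed (p,q)-shuffles with p + q = 4: an entry moved past
  g_i is conjugated by it, and (g k g^-1) g = g k makes the terms in which a g and a k are merged
  cancel in pairs. For q = 1 the two terms w[g_1|g_2|g_3], which would belong to q = 0, cancel too.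
*)
theory Submission
  imports Defs
begin

section \<open>Extension of cochains to formal combinations of symbols\<close>

lemma cochain_extend_superset:
  assumes "finite S" "Poly_Mapping.keys c \<subseteq> S"
  shows "cochain_extend F c = (\<Prod>s\<in>S. F s powi Poly_Mapping.lookup c s)"
  unfolding cochain_extend_def
  by (rule prod.mono_neutral_left) (use assms in \<open>auto simp: in_keys_iff\<close>)

text \<open>Cancellation can make the support of \<open>a + b\<close> smaller than the union of the
  two supports, so all three products are taken over that union, where extra symbols contribute a
  zeroth power. Nonvanishing of \<open>F\<close> is what makes powers additive for exponents of
  either sign.\<close>

lemma cochain_extend_add:
  assumes "\<And>s. s \<in> Poly_Mapping.keys a \<union> Poly_Mapping.keys b \<Longrightarrow> F s \<noteq> 0"
  shows "cochain_extend F (a + b) = cochain_extend F a * cochain_extend F b"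
proof -
  let ?S = "Poly_Mapping.keys a \<union> Poly_Mapping.keys b"
  have "cochain_extend F c = (\<Prod>s\<in>?S. F s powi Poly_Mapping.lookup c s)"
    if "Poly_Mapping.keys c \<subseteq> ?S" for c
    using that by (intro cochain_extend_superset) auto
  moreover have "Poly_Mapping.keys (a + b) \<subseteq> ?S"
    by (rule Poly_Mapping.keys_add)
  ultimately show ?thesis
    using assms by (simp add: lookup_add power_int_add prod.distrib)
qed

lemma cochain_extend_frag_of [simp]: "cochain_extend F (frag_of s) = F s"
  by (simp add: cochain_extend_def)

lemma cochain_extend_uminus: "cochain_extend F (- a) = inverse (cochain_extend F a)"
  by (simp add: cochain_extend_def keys_minus power_int_minus flip: prod_inversef[unfolded comp_def])

text \<open>The signs are those of the three (2,1)- or (1,2)-shuffles. The symbols may coincide for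
  particular group elements, so the value comes from additivity and not from the support.\<close>

lemma cochain_extend_three:
  assumes "F a \<noteq> 0" "F b \<noteq> 0" "F c \<noteq> 0"
  shows "cochain_extend F (frag_of a - frag_of b + frag_of c) = F a * F c / F b"
proof -
  have "Poly_Mapping.keys (frag_of a + - frag_of b) \<subseteq> {a, b}"
    using Poly_Mapping.keys_add[of "frag_of a" "- frag_of b"] by (auto simp: keys_minus)
  then have "cochain_extend F (frag_of a + - frag_of b + frag_of c)
      = cochain_extend F (frag_of a + - frag_of b) * F c"
    using assms by (subst cochain_extend_add) auto
  also have "cochain_extend F (frag_of a + - frag_of b) = F a * inverse (F b)"
    using assms by (subst cochain_extend_add) (auto simp: keys_minus cochain_extend_uminus)
  finally show ?thesis
    by (simp add: field_simps)
qed

section \<open>Shuffles of three letters\<close>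

lemma permutes_three_eqI:
  fixes l m :: "nat \<Rightarrow> nat"
  assumes "l permutes {1..3}" "m permutes {1..3}" "l 1 = m 1" "l 2 = m 2" "l 3 = m 3"
  shows "l = m"
proof
  fix i
  show "l i = m i"
  proof (cases "i \<in> {1..3}")
    case True
    then have "i = 1 \<or> i = 2 \<or> i = 3" by auto
    then show ?thesis using assms by auto
  next
    case False
    then show ?thesis using assms by (simp add: permutes_not_in)
  qed
qed

lemma permutes_three_values:
  fixes l :: "nat \<Rightarrow> nat"
  assumes "l permutes {1..3}"
  shows "l 1 \<in> {1, 2, 3}" "l 2 \<in> {1, 2, 3}" "l 3 \<in> {1, 2, 3}"
    "l 1 \<noteq> l 2" "l 1 \<noteq> l 3" "l 2 \<noteq> l 3"
proof -
  have "{1..3} = {1, 2, 3::nat}" by auto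
  then show "l 1 \<in> {1, 2, 3}" "l 2 \<in> {1, 2, 3}" "l 3 \<in> {1, 2, 3}"
    using permutes_in_image[OF assms] by auto
  show "l 1 \<noteq> l 2" "l 1 \<noteq> l 3" "l 2 \<noteq> l 3"
    using permutes_inj[OF assms] by (auto simp: inj_eq)
qed

lemma transpose_permutes_three:
  "transpose 1 2 permutes {1..3::nat}" "transpose 2 3 permutes {1..3::nat}"
  by (auto intro: permutes_swap_id)

text \<open>The two 3-cycles. The second argument of \<open>permutes_compose\<close> is applied
  last: the first fact concerns \<open>transpose 2 3 \<circ> transpose 1 2\<close>, the second
  \<open>transpose 1 2 \<circ> transpose 2 3\<close>.\<close>

lemmas cycle_permutes_three =
  permutes_compose[OF transpose_permutes_three(1) transpose_permutes_three(2)]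
  permutes_compose[OF transpose_permutes_three(2) transpose_permutes_three(1)]

text \<open>Monotonicity on an empty or one-point block is void, so only comparisons of neighbours
  in a longer block remain.\<close>

lemma shuffles_perm_three:
  "shuffles_perm 2 1 = {l. l permutes {1..3} \<and> l 1 < l 2}"
  "shuffles_perm 1 2 = {l. l permutes {1..3} \<and> l 2 < l 3}"
  "shuffles_perm 0 3 = {l. l permutes {1..3} \<and> l 1 < l 2 \<and> l 2 < l 3}"
proof -
  have sets: "{1..2} = {1, 2::nat}" "{2..3} = {2, 3::nat}" "{1..3} = {1, 2, 3::nat}"
    by auto
  have "strict_mono_on {1..2} l \<longleftrightarrow> l 1 < l 2"
    and "strict_mono_on {2..3} l \<longleftrightarrow> l 2 < l 3"
    and "strict_mono_on {1..3} l \<longleftrightarrow> l 1 < l 2 \<and> l 2 < l 3"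
    and "strict_mono_on {i..i} l" and "strict_mono_on {1..0} l" for l :: "nat \<Rightarrow> nat" and i :: nat
    unfolding sets by (auto simp: strict_mono_on_def)
  moreover have "2 + 1 = (3::nat)" "1 + 2 = (3::nat)" "1 + 1 = (2::nat)" "0 + 3 = (3::nat)"
    "0 + 1 = (1::nat)" by simp_all
  ultimately show
    "shuffles_perm 2 1 = {l. l permutes {1..3} \<and> l 1 < l 2}"
    "shuffles_perm 1 2 = {l. l permutes {1..3} \<and> l 2 < l 3}"
    "shuffles_perm 0 3 = {l. l permutes {1..3} \<and> l 1 < l 2 \<and> l 2 < l 3}"
    unfolding shuffles_perm_def by (simp_all only: simp_thms)
qed

text \<open>Such a shuffle is determined by the place \<open>l 3\<close> of the single k. In the
  order listed, k moves left past none, one or both of the g's.\<close>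

lemma shuffles_perm_2_1:
  "shuffles_perm 2 1 = {id, transpose 2 3, transpose 1 2 \<circ> transpose 2 3}" (is "_ = ?R")
proof (intro subset_antisym subsetI)
  fix l assume "l \<in> shuffles_perm 2 1"
  then have l: "l permutes {1..3}" "l 1 < l 2"
    unfolding shuffles_perm_three by auto
  consider "l 1 = 1" "l 2 = 2" "l 3 = 3" | "l 1 = 1" "l 2 = 3" "l 3 = 2"
    | "l 1 = 2" "l 2 = 3" "l 3 = 1"
    using permutes_three_values[OF l(1)] l(2) by auto
  then show "l \<in> ?R"
  proof cases
    case 1
    then show ?thesis using permutes_three_eqI[OF l(1) permutes_id] by simp
  next
    case 2
    then show ?thesis
      using permutes_three_eqI[OF l(1) transpose_permutes_three(2)] by (simp add: transpose_def)
  next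
    case 3
    then show ?thesis
      using permutes_three_eqI[OF l(1) cycle_permutes_three(2)] by (simp add: transpose_def)
  qed
next
  fix l assume "l \<in> ?R"
  then show "l \<in> shuffles_perm 2 1"
    unfolding shuffles_perm_three using transpose_permutes_three cycle_permutes_three
    by (auto simp: permutes_id transpose_def)
qed

text \<open>Here the place \<open>l 1\<close> of the single g determines the shuffle; in the order
  listed, g moves right past none, one or both of the k's.\<close>

lemma shuffles_perm_1_2:
  "shuffles_perm 1 2 = {id, transpose 1 2, transpose 2 3 \<circ> transpose 1 2}" (is "_ = ?R")
proof (intro subset_antisym subsetI)
  fix l assume "l \<in> shuffles_perm 1 2"
  then have l: "l permutes {1..3}" "l 2 < l 3"
    unfolding shuffles_perm_three by auto
  consider "l 1 = 1" "l 2 = 2" "l 3 = 3" | "l 1 = 2" "l 2 = 1" "l 3 = 3"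
    | "l 1 = 3" "l 2 = 1" "l 3 = 2"
    using permutes_three_values[OF l(1)] l(2) by auto
  then show "l \<in> ?R"
  proof cases
    case 1
    then show ?thesis using permutes_three_eqI[OF l(1) permutes_id] by simp
  next
    case 2
    then show ?thesis
      using permutes_three_eqI[OF l(1) transpose_permutes_three(1)] by (simp add: transpose_def)
  next
    case 3
    then show ?thesis
      using permutes_three_eqI[OF l(1) cycle_permutes_three(1)] by (simp add: transpose_def)
  qed
next
  fix l assume "l \<in> ?R"
  then show "l \<in> shuffles_perm 1 2"
    unfolding shuffles_perm_three using transpose_permutes_three cycle_permutes_three
    by (auto simp: permutes_id transpose_def)
qed

lemma shuffles_perm_0_3: "shuffles_perm 0 3 = {id}"
proof (intro subset_antisym subsetI)
  fix l assume "l \<in> shuffles_perm 0 3"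
  then have l: "l permutes {1..3}" "l 1 < l 2" "l 2 < l 3"
    unfolding shuffles_perm_three by auto
  have "l 1 = 1" "l 2 = 2" "l 3 = 3"
    using permutes_three_values[OF l(1)] l(2,3) by auto
  then show "l \<in> {id}"
    using permutes_three_eqI[OF l(1) permutes_id] by simp
qed (auto simp: shuffles_perm_three permutes_id)

section \<open>Shuffle symbols and their signed sums\<close>

lemma inv_into_permutes: "l permutes S \<Longrightarrow> a \<in> S \<Longrightarrow> l a = b \<Longrightarrow> inv_into S l b = a"
  by (simp add: inv_into_f_eq permutes_inj_on)


text \<open>The list \<open>[a, b, c]\<close> is the inverse permutation in one-line notation.
  Supplying it explicitly reduces a symbol to evaluating the entry function at three known
  indices.\<close>

lemma shuffle_symbol_three:
  assumes "l permutes {1..3}" "p + q = 3" "l a = 1" "l b = 2" "l c = 3" "{a, b, c} \<subseteq> {1..3}"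
  shows "shuffle_symbol G p q l (gs, ks) =
     map (\<lambda>i. if i \<le> p then gs ! (i - 1)
               else conjugate G (foldr (\<otimes>\<^bsub>G\<^esub>) (drop (p + l i - i) gs) \<one>\<^bsub>G\<^esub>) (ks ! (i - p - 1)))
       [a, b, c]"
proof -
  have "inv_into {1..3} l 1 = a" "inv_into {1..3} l 2 = b" "inv_into {1..3} l 3 = c"
    using assms by (auto intro!: inv_into_permutes)
  moreover have "[1..<4] = [1, 2, 3::nat]" by (simp add: numeral_eq_Suc)
  ultimately show ?thesis
    by (simp add: shuffle_symbol_def assms(2) Let_def)
qed

lemma sign_transpose_three: "sign (transpose 1 (2::nat)) = -1" "sign (transpose 2 (3::nat)) = -1"
  by (simp_all add: sign_swap_id)

lemma sign_cycle_three:
  "sign (transpose 1 2 \<circ> transpose 2 (3::nat)) = 1"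
  "sign (transpose 2 3 \<circ> transpose 1 (2::nat)) = 1"
  by (simp_all only: sign_compose[OF permutation_swap_id permutation_swap_id] sign_transpose_three
      mult_minus_left mult_minus_right minus_minus mult_1_left)

text \<open>No group axioms are available here: the products keep the trailing unit left by
  \<open>foldr\<close>, and the hypothesis handles conjugation by the empty product in the identity
  shuffle.\<close>

lemma shuffle_sum_2_1:
  "shuffle_sum G 2 1 ([g, h], [x]) =
     frag_of [g, h, x]
     - frag_of [g, conjugate G (h \<otimes>\<^bsub>G\<^esub> \<one>\<^bsub>G\<^esub>) x, h]
     + frag_of [conjugate G (g \<otimes>\<^bsub>G\<^esub> (h \<otimes>\<^bsub>G\<^esub> \<one>\<^bsub>G\<^esub>)) x, g, h]"
  if "conjugate G \<one>\<^bsub>G\<^esub> x = x"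
proof -
  let ?t = "transpose 2 (3::nat)" and ?c = "transpose 1 2 \<circ> transpose 2 (3::nat)"
  \<comment> \<open>These values tell the three permutations apart, so the sum over the set of
    shuffles really has three summands.\<close>
  have "?t 2 \<noteq> id 2" "?c 3 \<noteq> id 3" "?t 3 \<noteq> ?c 3"
    by (simp_all add: transpose_def)
  then have distinct: "id \<noteq> ?t" "id \<noteq> ?c" "?t \<noteq> ?c"
    by metis+
  have symbols:
    "shuffle_symbol G 2 1 id ([g, h], [x]) = [g, h, x]"
    "shuffle_symbol G 2 1 ?t ([g, h], [x]) = [g, conjugate G (h \<otimes>\<^bsub>G\<^esub> \<one>\<^bsub>G\<^esub>) x, h]"
    "shuffle_symbol G 2 1 ?c ([g, h], [x])
       = [conjugate G (g \<otimes>\<^bsub>G\<^esub> (h \<otimes>\<^bsub>G\<^esub> \<one>\<^bsub>G\<^esub>)) x, g, h]"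
    using that
    by (simp_all add: transpose_def
        shuffle_symbol_three[OF permutes_id, of 2 1 1 2 3]
        shuffle_symbol_three[OF transpose_permutes_three(2), of 2 1 1 3 2]
        shuffle_symbol_three[OF cycle_permutes_three(2), of 2 1 3 1 2] del: One_nat_def)
  show ?thesis
    using distinct unfolding shuffle_sum_def shuffles_perm_2_1
    by (simp add: symbols sign_id sign_transpose_three sign_cycle_three del: One_nat_def)
qed

lemma shuffle_sum_1_2:
  "shuffle_sum G 1 2 ([g], [x, y]) =
     frag_of [g, x, y]
     - frag_of [conjugate G (g \<otimes>\<^bsub>G\<^esub> \<one>\<^bsub>G\<^esub>) x, g, y]
     + frag_of [conjugate G (g \<otimes>\<^bsub>G\<^esub> \<one>\<^bsub>G\<^esub>) x, conjugate G (g \<otimes>\<^bsub>G\<^esub> \<one>\<^bsub>G\<^esub>) y, g]"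
  if "conjugate G \<one>\<^bsub>G\<^esub> x = x" "conjugate G \<one>\<^bsub>G\<^esub> y = y"
proof -
  let ?t = "transpose 1 (2::nat)" and ?c = "transpose 2 3 \<circ> transpose 1 (2::nat)"
  have "?t 2 \<noteq> id 2" "?c 3 \<noteq> id 3" "?t 3 \<noteq> ?c 3"
    by (simp_all add: transpose_def)
  then have distinct: "id \<noteq> ?t" "id \<noteq> ?c" "?t \<noteq> ?c"
    by metis+
  have symbols:
    "shuffle_symbol G 1 2 id ([g], [x, y]) = [g, x, y]"
    "shuffle_symbol G 1 2 ?t ([g], [x, y]) = [conjugate G (g \<otimes>\<^bsub>G\<^esub> \<one>\<^bsub>G\<^esub>) x, g, y]"
    "shuffle_symbol G 1 2 ?c ([g], [x, y])
       = [conjugate G (g \<otimes>\<^bsub>G\<^esub> \<one>\<^bsub>G\<^esub>) x, conjugate G (g \<otimes>\<^bsub>G\<^esub> \<one>\<^bsub>G\<^esub>) y, g]"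
    using that
    by (simp_all add: transpose_def
        shuffle_symbol_three[OF permutes_id, of 1 2 1 2 3]
        shuffle_symbol_three[OF transpose_permutes_three(1), of 1 2 2 1 3]
        shuffle_symbol_three[OF cycle_permutes_three(1), of 1 2 2 3 1] del: One_nat_def)
  show ?thesis
    using distinct unfolding shuffle_sum_def shuffles_perm_1_2
    by (simp add: symbols sign_id sign_transpose_three sign_cycle_three del: One_nat_def)
qed

lemma shuffle_sum_0_3:
  "shuffle_sum G 0 3 ([], [x, y, z]) = frag_of [x, y, z]"
  if "conjugate G \<one>\<^bsub>G\<^esub> x = x" "conjugate G \<one>\<^bsub>G\<^esub> y = y" "conjugate G \<one>\<^bsub>G\<^esub> z = z"
  using that unfolding shuffle_sum_def shuffles_perm_0_3
  by (simp add: sign_id shuffle_symbol_three[OF permutes_id, of 0 3 1 2 3] nth_Cons')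

section \<open>Short tuples and the bidegrees of total degree 3 and 4\<close>

lemma tuples_0 [simp]: "xs \<in> tuples G 0 \<longleftrightarrow> xs = []"
  by (auto simp: tuples_def)

lemma tuples_1 [simp]: "xs \<in> tuples G 1 \<longleftrightarrow> (\<exists>a\<in>carrier G. xs = [a])"
  by (auto simp: tuples_def length_Suc_conv)

lemma tuples_2 [simp]: "xs \<in> tuples G 2 \<longleftrightarrow> (\<exists>a\<in>carrier G. \<exists>b\<in>carrier G. xs = [a, b])"
  by (auto simp: tuples_def length_Suc_conv numeral_eq_Suc)

lemma tuples_3 [simp]:
  "xs \<in> tuples G 3 \<longleftrightarrow> (\<exists>a\<in>carrier G. \<exists>b\<in>carrier G. \<exists>c\<in>carrier G. xs = [a, b, c])"
  by (auto simp: tuples_def length_Suc_conv numeral_eq_Suc)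

lemma tuples_4 [simp]:
  "xs \<in> tuples G 4 \<longleftrightarrow>
    (\<exists>a\<in>carrier G. \<exists>b\<in>carrier G. \<exists>c\<in>carrier G. \<exists>d\<in>carrier G. xs = [a, b, c, d])"
  by (auto simp: tuples_def length_Suc_conv numeral_eq_Suc)

lemma tot_index_3: "tot_index 3 = {(2, 1), (1, 2), (0, 3)}"
  by (auto simp: tot_index_def)

lemma tot_index_4: "tot_index 4 = {(3, 1), (2, 2), (1, 3), (0, 4)}"
  by (auto simp: tot_index_def)

section \<open>The conjugation action\<close>

context group
begin

lemma conjugate_closed [simp]:
  "g \<in> carrier G \<Longrightarrow> x \<in> carrier G \<Longrightarrow> conjugate G g x \<in> carrier G"
  by (simp add: conjugate_def)

lemma conjugate_one [simp]: "x \<in> carrier G \<Longrightarrow> conjugate G \<one> x = x"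
  by (simp add: conjugate_def)

lemma conjugate_one_right [simp]: "g \<in> carrier G \<Longrightarrow> conjugate G g \<one> = \<one>"
  by (simp add: conjugate_def)

lemma conjugate_mult_left:
  "g \<in> carrier G \<Longrightarrow> h \<in> carrier G \<Longrightarrow> x \<in> carrier G \<Longrightarrow>
    conjugate G (g \<otimes> h) x = conjugate G g (conjugate G h x)"
  by (simp add: conjugate_def inv_mult_group m_assoc)

lemma conjugate_mult_right:
  "g \<in> carrier G \<Longrightarrow> x \<in> carrier G \<Longrightarrow> y \<in> carrier G \<Longrightarrow>
    conjugate G g (x \<otimes> y) = conjugate G g x \<otimes> conjugate G g y"
  by (simp add: conjugate_def m_assoc inv_solve_left)

text \<open>Used from left to right, it brings a merged pair from either of two neighbouring
  shuffles to the form \<open>g \<otimes> x\<close>, so that terms of opposite sign become identical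
  and cancel.\<close>

lemma conjugate_mult_self:
  "g \<in> carrier G \<Longrightarrow> x \<in> carrier G \<Longrightarrow> conjugate G g x \<otimes> g = g \<otimes> x"
  by (simp add: conjugate_def m_assoc)

end

section \<open>The 3-cocycle and the cochains built from it\<close>

locale circle_3_cocycle = group G for G (structure) +
  fixes w :: "'a list \<Rightarrow> complex"
  assumes cocycle: "w \<in> bar_cocycles G 3"
begin

lemma norm_w [simp]:
  assumes "a \<in> carrier G" "b \<in> carrier G" "c \<in> carrier G"
  shows "cmod (w [a, b, c]) = 1"
proof -
  have "[a, b, c] \<in> tuples G 3"
    using assms by (simp add: tuples_def)
  then show ?thesis
    using cocycle by (auto simp: bar_cocycles_def kernel_def bar_cochains_def circle_group_def)
qed

lemma w_nonzero [simp]: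
  "a \<in> carrier G \<Longrightarrow> b \<in> carrier G \<Longrightarrow> c \<in> carrier G \<Longrightarrow> w [a, b, c] \<noteq> 0"
  by (metis norm_w norm_zero zero_neq_one)

lemma w_normalized:
  assumes "a \<in> carrier G" "b \<in> carrier G" "c \<in> carrier G" "\<one> \<in> {a, b, c}"
  shows "w [a, b, c] = 1"
proof -
  have "[a, b, c] \<in> tuples G 3"
    using assms by (simp add: tuples_def)
  then show ?thesis
    using cocycle assms(4) by (auto simp: bar_cocycles_def kernel_def bar_cochains_def)
qed

text \<open>The value of \<open>bar_diff G 3 w\<close> on \<open>[a, b, c, d]\<close>, with the
  faces of negative sign collected in the denominator.\<close>

definition coboundary :: "'a \<Rightarrow> 'a \<Rightarrow> 'a \<Rightarrow> 'a \<Rightarrow> complex" where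
  "coboundary a b c d = w [b, c, d] * w [a, b \<otimes> c, d] * w [a, b, c]
     / (w [a \<otimes> b, c, d] * w [a, b, c \<otimes> d])"

lemma coboundary_eq_1:
  assumes "a \<in> carrier G" "b \<in> carrier G" "c \<in> carrier G" "d \<in> carrier G"
  shows "coboundary a b c d = 1"
proof -
  have abcd: "[a, b, c, d] \<in> tuples G 4"
    using assms by (simp add: tuples_def)
  have "bar_diff G 3 w = \<one>\<^bsub>bar_cochains G 4\<^esub>"
    using cocycle by (simp add: bar_cocycles_def kernel_def)
  \<comment> \<open>The unit of the cochain group is the constant 1 on tuples only, hence the appeal
    to \<open>abcd\<close>.\<close>
  then have "bar_diff G 3 w [a, b, c, d] = 1"
    using abcd by (simp add: bar_cochains_def circle_group_def)
  moreover have "{1..3} = {1, 2, 3::nat}"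
    by auto
  ultimately show ?thesis
    using abcd assms
    by (simp add: bar_diff_def coboundary_def merge_at_def power_int_minus field_simps)
qed

text \<open>Iterated conjugates are the form to which \<open>conjugate_mult_left\<close> also brings
  the differentials and the shuffle sum.\<close>

lemma alpha_eq:
  assumes "g \<in> carrier G" "h \<in> carrier G" "x \<in> carrier G"
  shows "alpha_cochain G w ([g, h], [x]) =
    w [g, h, x] * w [conjugate G g (conjugate G h x), g, h] / w [g, conjugate G h x, h]"
  using assms
  by (simp add: alpha_cochain_def tuples_def conjugate_def inv_mult_group m_assoc)

lemma beta_eq:
  assumes "g \<in> carrier G" "x \<in> carrier G" "y \<in> carrier G"
  shows "beta_cochain G w ([g], [x, y]) =
    w [g, x, y] * w [conjugate G g x, conjugate G g y, g] / w [conjugate G g x, g, y]"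
  using assms by (simp add: beta_cochain_def tuples_def conjugate_def)

lemma theta_eq:
  assumes "x \<in> carrier G" "y \<in> carrier G" "z \<in> carrier G"
  shows "theta_cochain G w ([], [x, y, z]) = w [x, y, z]"
  using assms by (simp add: theta_cochain_def tuples_def)

lemma alpha_extensional: "alpha_cochain G w \<in> extensional (tuples G 2 \<times> tuples G 1)"
  by (simp add: alpha_cochain_def)

text \<open>Each of the three factors contains \<open>g\<close>, \<open>h\<close> and
  \<open>x\<close> or a conjugate of \<open>x\<close>. A conjugate of the unit is the unit, so
  normalization is inherited from \<open>w\<close>.\<close>

lemma alpha_in_double_cochains: "alpha_cochain G w \<in> carrier (double_cochains G 2 1)"
  using alpha_extensional
  by (auto simp: double_cochains_def circle_group_def PiE_def alpha_eq norm_mult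
        norm_divide w_normalized simp del: One_nat_def)

lemma beta_extensional: "beta_cochain G w \<in> extensional (tuples G 1 \<times> tuples G 2)"
  by (simp add: beta_cochain_def)

lemma beta_in_double_cochains: "beta_cochain G w \<in> carrier (double_cochains G 1 2)"
  using beta_extensional
  by (auto simp: double_cochains_def circle_group_def PiE_def beta_eq norm_mult
        norm_divide w_normalized simp del: One_nat_def)

lemma theta_extensional: "theta_cochain G w \<in> extensional (tuples G 0 \<times> tuples G 3)"
  by (simp add: theta_cochain_def)

lemma theta_in_double_cochains: "theta_cochain G w \<in> carrier (double_cochains G 0 3)"
  using theta_extensional
  by (auto simp: double_cochains_def circle_group_def PiE_def theta_eq
        w_normalized)

section \<open>The cocycle condition in the total complex\<close>

lemma delta_G_alpha:
  assumes "a \<in> carrier G" "b \<in> carrier G" "c \<in> carrier G" "x \<in> carrier G"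
  shows "delta_G G 2 1 (alpha_cochain G w) ([a, b, c], [x]) = 1"
proof -
  let ?z = "conjugate G c x" let ?y = "conjugate G b ?z"
  have "{1..2} = {1, 2::nat}"
    by auto
  \<comment> \<open>The denominator holds the two odd shuffles, where \<open>x\<close> has moved
    left past one or all three of \<open>a\<close>, \<open>b\<close>, \<open>c\<close>, being
    conjugated by each.\<close>
  then have "delta_G G 2 1 (alpha_cochain G w) ([a, b, c], [x]) =
    coboundary a b c x * coboundary a ?y b c
      / (coboundary a b ?z c * coboundary (conjugate G a ?y) a b c)"
    using assms
    by (simp add: delta_G_def tuples_def merge_at_def alpha_eq coboundary_def power_int_minus
        conjugate_mult_left conjugate_mult_self field_simps)
  then show ?thesis
    using assms by (simp add: coboundary_eq_1)
qed

text \<open>Bidegree (2,2), where \<delta>_K has exponent 1. Of the six shuffles, the four with 0, 2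
  or 4 crossings of a g and a k enter with a plus sign, those with 1 or 3 crossings with a minus
  sign.\<close>

lemma delta_G_beta_delta_K_alpha:
  assumes "g \<in> carrier G" "h \<in> carrier G" "x \<in> carrier G" "y \<in> carrier G"
  shows "delta_G G 1 2 (beta_cochain G w) ([g, h], [x, y])
    * delta_K G 2 1 (alpha_cochain G w) ([g, h], [x, y]) = 1"
proof -
  let ?x = "conjugate G h x" let ?y = "conjugate G h y"
  have "delta_G G 1 2 (beta_cochain G w) ([g, h], [x, y])
    * delta_K G 2 1 (alpha_cochain G w) ([g, h], [x, y]) =
      coboundary g h x y * coboundary g ?x ?y h
      * coboundary (conjugate G g ?x) g h y
      * coboundary (conjugate G g ?x) (conjugate G g ?y) g h
      / (coboundary g ?x h y * coboundary (conjugate G g ?x) g ?y h)"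
    using assms
    by (simp add: delta_G_def delta_K_def tuples_def merge_at_def alpha_eq beta_eq coboundary_def
        power_int_minus conjugate_mult_left conjugate_mult_right conjugate_mult_self field_simps)
  then show ?thesis
    using assms by (simp add: coboundary_eq_1)
qed

text \<open>Bidegree (1,3): the odd p accounts for the inverse of \<delta>_K. The four shuffles are
  given by the place of \<open>g\<close>, with alternating signs.\<close>

lemma delta_G_theta_delta_K_beta:
  assumes "g \<in> carrier G" "x \<in> carrier G" "y \<in> carrier G" "z \<in> carrier G"
  shows "delta_G G 0 3 (theta_cochain G w) ([g], [x, y, z])
    * inverse (delta_K G 1 2 (beta_cochain G w) ([g], [x, y, z])) = 1"
proof -
  let ?x = "conjugate G g x" let ?y = "conjugate G g y" let ?z = "conjugate G g z"
  have "{1..2} = {1, 2::nat}"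
    by auto
  then have "delta_G G 0 3 (theta_cochain G w) ([g], [x, y, z])
    * inverse (delta_K G 1 2 (beta_cochain G w) ([g], [x, y, z])) =
      coboundary g x y z * coboundary ?x ?y g z
      / (coboundary ?x g y z * coboundary ?x ?y ?z g)"
    using assms
    by (simp add: delta_G_def delta_K_def tuples_def merge_at_def beta_eq theta_eq coboundary_def
        power_int_minus conjugate_mult_right conjugate_mult_self field_simps)
  then show ?thesis
    using assms by (simp add: coboundary_eq_1)
qed

text \<open>With no g present the only shuffle is the identity, and the cocycle identity of
  \<open>w\<close> appears unchanged.\<close>

lemma delta_K_theta:
  assumes "x \<in> carrier G" "y \<in> carrier G" "z \<in> carrier G" "t \<in> carrier G"
  shows "delta_K G 0 3 (theta_cochain G w) ([], [x, y, z, t]) = 1"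
proof -
  have "{1..3} = {1, 2, 3::nat}"
    by auto
  then have "delta_K G 0 3 (theta_cochain G w) ([], [x, y, z, t]) = coboundary x y z t"
    using assms
    by (simp add: delta_K_def tuples_def merge_at_def theta_eq coboundary_def
        power_int_minus field_simps)
  then show ?thesis
    using assms by (simp add: coboundary_eq_1)
qed

lemma tot_diff_eq_one:
  "tot_diff G 3 (oplus_tot3 (alpha_cochain G w) (beta_cochain G w) (theta_cochain G w))
    = \<one>\<^bsub>tot_cochains G 4\<^esub>" (is "tot_diff G 3 ?F = _")
proof -
  \<comment> \<open>The default branch of \<open>oplus_tot3\<close> is reached only at (0,3), the
    one remaining bidegree.\<close>
  have F: "?F (2, 1) = alpha_cochain G w" "?F (1, 2) = beta_cochain G w"
    "?F (0, 3) = theta_cochain G w"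
    by (simp_all add: oplus_tot3_def tot_index_3)
  have "tot_diff G 3 ?F (p, q) = (\<lambda>gk\<in>tuples G p \<times> tuples G q. 1)"
    if pq: "(p, q) \<in> tot_index 4" for p q
  proof (rule ext)
    fix gk :: "'a list \<times> 'a list"
    \<comment> \<open>At (3,1) the \<delta>_K part is absent, since it would start from q = 0; at
      (0,4) the \<delta>_G part is absent.\<close>
    consider "p = 3" "q = 1" | "p = 2" "q = 2" | "p = 1" "q = 3" | "p = 0" "q = 4"
      using pq unfolding tot_index_4 by auto
    then show "tot_diff G 3 ?F (p, q) gk = (\<lambda>gk\<in>tuples G p \<times> tuples G q. 1) gk"
    proof cases
      case 1
      then show ?thesis
        by (auto simp: tot_diff_def tot_index_4 restrict_def F delta_G_alpha simp del: One_nat_def)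
    next
      case 2
      then show ?thesis
        by (auto simp: tot_diff_def tot_index_4 restrict_def F[unfolded One_nat_def]
            delta_G_beta_delta_K_alpha[unfolded One_nat_def])
    next
      case 3
      then show ?thesis
        by (auto simp: tot_diff_def tot_index_4 restrict_def F power_int_minus
            delta_G_theta_delta_K_beta simp del: One_nat_def)
    next
      case 4
      then show ?thesis
        by (auto simp: tot_diff_def tot_index_4 restrict_def F delta_K_theta simp del: One_nat_def)
    qed
  qed
  \<comment> \<open>Outside \<open>tot_index 4\<close> both sides are
    \<open>undefined\<close>.\<close>
  then show ?thesis
    by (auto simp: fun_eq_iff tot_diff_def tot_cochains_def double_cochains_def circle_group_def)
qed

lemma oplus_in_tot_cocycles:
  "oplus_tot3 (alpha_cochain G w) (beta_cochain G w) (theta_cochain G w) \<in> tot_cocycles G 3"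
proof -
  have "oplus_tot3 (alpha_cochain G w) (beta_cochain G w) (theta_cochain G w)
      \<in> carrier (tot_cochains G 3)"
    using alpha_in_double_cochains beta_in_double_cochains theta_in_double_cochains
    by (auto simp: tot_cochains_def oplus_tot3_def tot_index_3 simp del: One_nat_def)
  then show ?thesis
    using tot_diff_eq_one by (simp add: tot_cocycles_def kernel_def)
qed

section \<open>Comparison with the restricted shuffle homomorphism\<close>

lemma shuffle_alpha:
  assumes "g \<in> carrier G" "h \<in> carrier G" "x \<in> carrier G"
  shows "cochain_extend w (shuffle_sum G 2 1 ([g, h], [x])) = alpha_cochain G w ([g, h], [x])"
  using assms
  by (simp add: shuffle_sum_2_1 cochain_extend_three alpha_eq conjugate_mult_left
      del: One_nat_def)

lemma shuffle_beta:
  assumes "g \<in> carrier G" "x \<in> carrier G" "y \<in> carrier G"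
  shows "cochain_extend w (shuffle_sum G 1 2 ([g], [x, y])) = beta_cochain G w ([g], [x, y])"
  using assms
  by (simp add: shuffle_sum_1_2 cochain_extend_three beta_eq del: One_nat_def)

lemma shuffle_theta:
  assumes "x \<in> carrier G" "y \<in> carrier G" "z \<in> carrier G"
  shows "cochain_extend w (shuffle_sum G 0 3 ([], [x, y, z])) = theta_cochain G w ([], [x, y, z])"
  using assms by (simp add: shuffle_sum_0_3 theta_eq)

text \<open>Both sides are extensional in the bidegree and in the symbol, so agreement on actual
  symbols in the three bidegrees gives equality of functions.\<close>

lemma oplus_eq_restricted_shuffle_hom:
  "oplus_tot3 (alpha_cochain G w) (beta_cochain G w) (theta_cochain G w)
    = restricted_shuffle_hom G 3 w"
proof -
  have "alpha_cochain G w
      = (\<lambda>gk\<in>tuples G 2 \<times> tuples G 1. cochain_extend w (shuffle_sum G 2 1 gk))"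
    by (rule extensionalityI[OF alpha_extensional])
      (auto simp: shuffle_alpha simp del: One_nat_def)
  moreover have "beta_cochain G w
      = (\<lambda>gk\<in>tuples G 1 \<times> tuples G 2. cochain_extend w (shuffle_sum G 1 2 gk))"
    by (rule extensionalityI[OF beta_extensional])
      (auto simp: shuffle_beta simp del: One_nat_def)
  moreover have "theta_cochain G w
      = (\<lambda>gk\<in>tuples G 0 \<times> tuples G 3. cochain_extend w (shuffle_sum G 0 3 gk))"
    by (rule extensionalityI[OF theta_extensional])
      (auto simp: shuffle_theta simp del: One_nat_def)
  ultimately show ?thesis
    by (auto simp: fun_eq_iff oplus_tot3_def restricted_shuffle_hom_def restrict_def tot_index_3
        simp del: One_nat_def)
qed

end

theorem lemma3p14:
  fixes G :: "('a, 'm) monoid_scheme" and w :: "'a list \<Rightarrow> complex"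
  assumes "group G" and "w \<in> bar_cocycles G 3"
  shows "oplus_tot3 (alpha_cochain G w) (beta_cochain G w) (theta_cochain G w) \<in> tot_cocycles G 3
    \<and> oplus_tot3 (alpha_cochain G w) (beta_cochain G w) (theta_cochain G w)
        = restricted_shuffle_hom G 3 w"
proof -
  interpret circle_3_cocycle G w
    using assms by (simp add: circle_3_cocycle_def circle_3_cocycle_axioms_def)
  show ?thesis
    using oplus_in_tot_cocycles oplus_eq_restricted_shuffle_hom by simp
qed

end
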